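(* Let $(X,d,\succcurlyeq)$ be a radial metric poset and $S$ a subset of $X$. Then for every $\succcurlyeq$-increasing uniformly continuous function $f:S\to\mathbb{R}$ which is Lipschitz for large distances, there exists an $\succcurlyeq$-increasing uniformly continuous function $F:X\to\mathbb{R}$ with $F|_S=f$.
   Context: A metric poset is a triple $(X,d,\succcurlyeq)$ where $X$ is a nonempty set, $(X,d)$ is a metric space, and $\succcurlyeq$ is a partial order on $X$ that is closed as a subset of $X\times X$. Write $x\succ y$ if $x\succcurlyeq y$ and $x\neq y$, and write $x\succcurlyeq^{\bullet}y$ if it is not the case that $y\succcurlyeq x$. $(X,d,\succcurlyeq)$ is radial if for all $x,y,z\in X$: (i) $x\succcurlyeq^{\bullet}y\succ z$ implies $d(x,z)\ge d(x,y)$; and (ii) $x\succ y\succcurlyeq^{\bullet}z$ implies $d(x,z)\ge d(y,z)$. For $A\subseteq X$, a function $g:A\to\mathbb{R}$ is $\succcurlyeq$-increasing if $g(x)\ge g(y)$ for all $x,y\in A$ with $x\succcurlyeq y$; it is Lipschitz for large distances if for every $\delta>0$ there is $K_\delta>0$ such that $|g(x)-g(y)|\le K_\delta d(x,y)$ for all $x,y\in A$ with $d(x,y)\ge\delta$. Subsets of $X$ carry the metric $d$ restricted to them. *)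

theory Defs
  imports "HOL-Analysis.Analysis"
begin

text \<open>The space \<open>X\<close> is the universe of the type \<open>'a\<close> and \<open>d\<close> is \<open>dist\<close>; the order is a separate
  parameter, unrelated to any order class on \<open>'a\<close>.\<close>

locale metric_poset =
  fixes geq :: "'a::metric_space \<Rightarrow> 'a \<Rightarrow> bool"  (infix "\<succeq>" 50)
  assumes refl_geq: "reflp (\<succeq>)"
    and antisym_geq: "antisymp (\<succeq>)"
    and trans_geq: "transp (\<succeq>)"
    and closed_geq: "closed {(x, y). x \<succeq> y}"
begin

definition strict :: "'a \<Rightarrow> 'a \<Rightarrow> bool"  (infix "\<succ>" 50)
  where "x \<succ> y \<longleftrightarrow> x \<succeq> y \<and> x \<noteq> y"

text \<open>Holds in particular for incomparable \<open>x\<close> and \<open>y\<close>; it coincides with \<open>x \<succ> y\<close> only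
  when the order is total.\<close>

definition not_below :: "'a \<Rightarrow> 'a \<Rightarrow> bool"  (infix "\<succeq>\<^sup>\<bullet>" 50)
  where "x \<succeq>\<^sup>\<bullet> y \<longleftrightarrow> \<not> y \<succeq> x"

end

locale radial_metric_poset = metric_poset +
  assumes radial_fst: "\<And>x y z. x \<succeq>\<^sup>\<bullet> y \<Longrightarrow> y \<succ> z \<Longrightarrow> dist x z \<ge> dist x y"
    and radial_snd: "\<And>x y z. x \<succ> y \<Longrightarrow> y \<succeq>\<^sup>\<bullet> z \<Longrightarrow> dist x z \<ge> dist y z"

definition lipschitz_for_large_distances_on :: "'a::metric_space set \<Rightarrow> ('a \<Rightarrow> real) \<Rightarrow> bool"
  where "lipschitz_for_large_distances_on A g \<longleftrightarrow>
    (\<forall>\<delta>>0. \<exists>K>0. \<forall>x\<in>A. \<forall>y\<in>A. dist x y \<ge> \<delta> \<longrightarrow> \<bar>g x - g y\<bar> \<le> K * dist x y)"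

end

theory Submission
  imports Defs
begin

text \<open>The idea is to encode order and metric in one asymmetric distance: let \<open>D x y\<close> be \<open>0\<close> if
  \<open>y \<succeq> x\<close>, and \<open>dist x y\<close> otherwise. Radiality is what makes \<open>D\<close> satisfy the triangle inequality
  (\<open>radial_metric_poset.up_dist_triangle\<close>). For a function \<open>\<omega>\<close> with \<open>\<omega> 0 = 0\<close>, the single family of
  inequalities \<open>g x - g y \<le> \<omega> (D x y)\<close> says both that \<open>g\<close> is increasing, from the pairs with \<open>D x y = 0\<close>,
  and, if \<open>\<omega>\<close> is nonnegative, monotone and small near \<open>0\<close>, that \<open>g\<close> is uniformly continuous.

  A uniformly continuous function that is Lipschitz for large distances has a modulus of continuity
  \<open>\<omega>\<close> which is an infimum of increasing affine functions, hence concave and so subadditive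
  (\<open>subadditive_modulus\<close>). Then \<open>\<omega> (D x y)\<close> inherits the triangle inequality from \<open>D\<close>, and the McShane
  formula \<open>F x = Inf {f s + \<omega> (D x s) | s. s \<in> S}\<close>, applied to this asymmetric distance
  (\<open>McShane_extension_quasi\<close>), extends \<open>f\<close> with the same family of inequalities.\<close>

section \<open>One-sided McShane extension\<close>

text \<open>The infimum is finite since, for a fixed \<open>s\<^sub>0 \<in> S\<close>, the triangle inequality through \<open>x\<close> bounds
  every \<open>f s + q x s\<close> from below by \<open>f s\<^sub>0 - q s\<^sub>0 x\<close>.\<close>

lemma McShane_extension_quasi:
  fixes q :: "'a \<Rightarrow> 'a \<Rightarrow> real" and f :: "'a \<Rightarrow> real"
  assumes q_self: "\<And>x. q x x = 0"
    and q_triangle: "\<And>x y z. q x z \<le> q x y + q y z"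
    and f_le: "\<And>x y. x \<in> S \<Longrightarrow> y \<in> S \<Longrightarrow> f x - f y \<le> q x y"
  obtains F where "\<And>x. x \<in> S \<Longrightarrow> F x = f x" and "\<And>x y. F x - F y \<le> q x y"
proof (cases "S = {}")
  case True
  \<comment> \<open>\<open>q\<close> may take negative values, so a constant function need not work; a column of \<open>q\<close> does.\<close>
  show ?thesis
  proof (rule that[of "\<lambda>x. q x undefined"])
    show "q x undefined - q y undefined \<le> q x y" for x y
      using q_triangle[of x undefined y] by linarith
  qed (simp add: True)
next
  case False
  then obtain s0 where s0: "s0 \<in> S" by blast
  define F where "F x = (INF s\<in>S. f s + q x s)" for x
  have bdd: "bdd_below ((\<lambda>s. f s + q x s) ` S)" for x
  proof (rule bdd_belowI2)
    fix s assume "s \<in> S"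
    then show "f s0 - q s0 x \<le> f s + q x s"
      using f_le[OF s0, of s] q_triangle[of s0 s x] by linarith
  qed
  have "F x = f x" if "x \<in> S" for x
  proof (rule antisym)
    show "F x \<le> f x"
      unfolding F_def using cINF_lower[OF bdd that, of x] q_self by simp
    show "f x \<le> F x"
      unfolding F_def using that False f_le by (intro cINF_greatest) (auto simp: algebra_simps)
  qed
  moreover have "F x - F y \<le> q x y" for x y
  proof -
    have "F x - q x y \<le> f s + q y s" if "s \<in> S" for s
      using cINF_lower[OF bdd that, of x] q_triangle[of x s y] unfolding F_def by linarith
    then have "F x - q x y \<le> F y"
      unfolding F_def[of y] using False by (intro cINF_greatest) auto
    then show ?thesis by linarith
  qed
  ultimately show ?thesis using that by blast
qed

section \<open>Subadditive moduli of continuity\<close>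

text \<open>Uniform continuity handles the pairs closer than some \<open>\<delta>\<close>, the Lipschitz bound the others.\<close>

lemma affine_bound:
  fixes f :: "'a::metric_space \<Rightarrow> real"
  assumes "uniformly_continuous_on S f"
    and "lipschitz_for_large_distances_on S f"
    and "0 < \<epsilon>"
  obtains K where "0 \<le> K" and "\<And>x y. x \<in> S \<Longrightarrow> y \<in> S \<Longrightarrow> \<bar>f x - f y\<bar> \<le> \<epsilon> + K * dist x y"
proof -
  obtain \<delta> where \<delta>: "0 < \<delta>" "\<And>x y. x \<in> S \<Longrightarrow> y \<in> S \<Longrightarrow> dist x y < \<delta> \<Longrightarrow> \<bar>f x - f y\<bar> < \<epsilon>"
    using assms(1) \<open>0 < \<epsilon>\<close> unfolding uniformly_continuous_on_def dist_real_def by metis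
  then obtain K where K: "0 < K"
      "\<And>x y. x \<in> S \<Longrightarrow> y \<in> S \<Longrightarrow> \<delta> \<le> dist x y \<Longrightarrow> \<bar>f x - f y\<bar> \<le> K * dist x y"
    using assms(2) unfolding lipschitz_for_large_distances_on_def by metis
  have "\<bar>f x - f y\<bar> \<le> \<epsilon> + K * dist x y" if "x \<in> S" "y \<in> S" for x y
  proof (cases "dist x y < \<delta>")
    case True
    moreover have "0 \<le> K * dist x y" using K(1) by simp
    ultimately show ?thesis using \<delta>(2)[OF that] by linarith
  next
    case False
    then show ?thesis using K(2)[OF that] \<open>0 < \<epsilon>\<close> by simp
  qed
  then show ?thesis using that[of K] K(1) by simp
qed

text \<open>The modulus is the infimum of all affine functions \<open>\<lambda>t. a + k * t\<close> with \<open>a, k \<ge> 0\<close> that bound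
  the oscillation of \<open>f\<close>. Taking the infimum keeps the bound and gives concavity for free, while
  \<open>affine_bound\<close> provides competitors with arbitrarily small \<open>a\<close>, so it vanishes at \<open>0\<close>
  and is continuous there.\<close>

lemma subadditive_modulus:
  fixes f :: "'a::metric_space \<Rightarrow> real"
  assumes "uniformly_continuous_on S f"
    and "lipschitz_for_large_distances_on S f"
  obtains \<omega> :: "real \<Rightarrow> real"
  where "\<omega> 0 = 0"
    and "\<And>s t. 0 \<le> s \<Longrightarrow> s \<le> t \<Longrightarrow> \<omega> s \<le> \<omega> t"
    and "\<And>s t. 0 \<le> s \<Longrightarrow> 0 \<le> t \<Longrightarrow> \<omega> (s + t) \<le> \<omega> s + \<omega> t"
    and "\<And>\<epsilon>. 0 < \<epsilon> \<Longrightarrow> \<exists>\<delta>>0. \<forall>t. 0 \<le> t \<and> t < \<delta> \<longrightarrow> \<omega> t < \<epsilon>"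
    and "\<And>x y. x \<in> S \<Longrightarrow> y \<in> S \<Longrightarrow> \<bar>f x - f y\<bar> \<le> \<omega> (dist x y)"
proof -
  define P where "P = {(a, k). 0 \<le> a \<and> 0 \<le> k \<and>
    (\<forall>x\<in>S. \<forall>y\<in>S. \<bar>f x - f y\<bar> \<le> a + k * dist x y)}"
  define \<omega> where "\<omega> t = (INF (a, k)\<in>P. a + k * t)" for t :: real
  have small: "\<exists>k\<ge>0. (\<epsilon>, k) \<in> P" if pos: "0 < \<epsilon>" for \<epsilon>
  proof -
    obtain K where "0 \<le> K" "\<And>x y. x \<in> S \<Longrightarrow> y \<in> S \<Longrightarrow> \<bar>f x - f y\<bar> \<le> \<epsilon> + K * dist x y"
      using affine_bound[OF assms pos] by blast
    then show ?thesis using pos by (auto simp: P_def)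
  qed
  then have ne: "P \<noteq> {}" using zero_less_one by blast
  have lower: "\<omega> t \<le> a + k * t" if "(a, k) \<in> P" "0 \<le> t" for a k t
  proof -
    have "bdd_below ((\<lambda>(a, k). a + k * t) ` P)"
      using \<open>0 \<le> t\<close> by (intro bdd_belowI2[where m = 0]) (auto simp: P_def)
    from cINF_lower[OF this that(1)] show ?thesis unfolding \<omega>_def by simp
  qed
  have greatest: "c \<le> \<omega> t" if "\<And>a k. (a, k) \<in> P \<Longrightarrow> c \<le> a + k * t" for c t
    unfolding \<omega>_def using ne that by (intro cINF_greatest) auto
  show ?thesis
  proof
    have "\<omega> 0 \<le> \<epsilon>" if "0 < \<epsilon>" for \<epsilon>
      using small[OF that] lower[of \<epsilon> _ 0] by auto
    then have "\<omega> 0 \<le> 0" by (rule field_le_epsilon) simp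
    moreover have "0 \<le> \<omega> 0" by (rule greatest) (simp add: P_def)
    ultimately show "\<omega> 0 = 0" by simp
  next
    fix s t :: real assume st: "0 \<le> s" "s \<le> t"
    show "\<omega> s \<le> \<omega> t"
    proof (rule greatest)
      fix a k assume ak: "(a, k) \<in> P"
      then have "k * s \<le> k * t" using st by (simp add: P_def mult_left_mono)
      then show "\<omega> s \<le> a + k * t" using lower[OF ak st(1)] by linarith
    qed
  next
    fix s t :: real assume st: "0 \<le> s" "0 \<le> t"
    have pair: "\<omega> (s + t) \<le> (a + k * s) + (b + l * t)" if "(a, k) \<in> P" "(b, l) \<in> P" for a k b l
    proof (cases "k \<le> l")
      \<comment> \<open>Of the two competitors, the one with the smaller slope serves for \<open>s + t\<close>.\<close>
      case True
      then have "k * t \<le> l * t" using st by (simp add: mult_right_mono)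
      then show ?thesis using lower[OF that(1), of "s + t"] st that(2)
        by (simp add: P_def algebra_simps)
    next
      case False
      then have "l * s \<le> k * s" using st by (simp add: mult_right_mono)
      then show ?thesis using lower[OF that(2), of "s + t"] st that(1)
        by (simp add: P_def algebra_simps)
    qed
    have "\<omega> (s + t) - (b + l * t) \<le> \<omega> s" if "(b, l) \<in> P" for b l
    proof (rule greatest)
      show "\<omega> (s + t) - (b + l * t) \<le> a + k * s" if "(a, k) \<in> P" for a k
        using pair[OF that \<open>(b, l) \<in> P\<close>] by linarith
    qed
    then have "\<omega> (s + t) - \<omega> s \<le> \<omega> t"
      by (intro greatest) (simp add: algebra_simps)
    then show "\<omega> (s + t) \<le> \<omega> s + \<omega> t" by linarith
  next
    fix \<epsilon> :: real assume "0 < \<epsilon>"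
    then obtain k where k: "0 \<le> k" "(\<epsilon> / 2, k) \<in> P" using small[of "\<epsilon> / 2"] by auto
    \<comment> \<open>The \<open>+ 1\<close> only guards against \<open>k = 0\<close>.\<close>
    define \<delta> where "\<delta> = \<epsilon> / (2 * (k + 1))"
    have "0 < \<delta>" using \<open>0 < \<epsilon>\<close> k(1) by (simp add: \<delta>_def)
    moreover have "\<omega> t < \<epsilon>" if "0 \<le> t" "t < \<delta>" for t
    proof -
      have "k * t \<le> (k + 1) * t" using that by (simp add: algebra_simps)
      also have "\<dots> < (k + 1) * \<delta>" using that k(1) by simp
      also have "\<dots> = \<epsilon> / 2" using k(1) by (simp add: \<delta>_def field_simps)
      finally show ?thesis using lower[OF k(2) that(1)] by linarith
    qed
    ultimately show "\<exists>\<delta>>0. \<forall>t. 0 \<le> t \<and> t < \<delta> \<longrightarrow> \<omega> t < \<epsilon>" by blast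
  next
    fix x y assume "x \<in> S" "y \<in> S"
    then show "\<bar>f x - f y\<bar> \<le> \<omega> (dist x y)"
      by (intro greatest) (simp add: P_def)
  qed
qed

section \<open>The asymmetric distance of a radial metric poset\<close>

text \<open>The cost of going from \<open>x\<close> to \<open>y\<close> when upward moves are free. An increasing function can
  only lose value where this cost is positive, which is why the cost bounds differences one-sidedly.\<close>

definition (in metric_poset) up_dist :: "'a \<Rightarrow> 'a \<Rightarrow> real"
  where "up_dist x y = (if geq y x then 0 else dist x y)"

lemma (in metric_poset) up_dist_self: "up_dist x x = 0"
  using refl_geq by (simp add: up_dist_def reflp_def)

lemma (in metric_poset) up_dist_nonneg: "0 \<le> up_dist x y"
  by (simp add: up_dist_def)

lemma (in metric_poset) up_dist_le_dist: "up_dist x y \<le> dist x y"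
  by (simp add: up_dist_def)

text \<open>Let \<open>z \<succeq> x\<close> fail, so that by transitivity the legs \<open>x\<close> to \<open>y\<close> and \<open>y\<close> to \<open>z\<close> are not
  both free. If neither is, this is the triangle inequality of the metric. If exactly one is free,
  it must be shown that replacing \<open>y\<close> by the endpoint across the free leg does not
  increase the distance; these are precisely the two radiality conditions.\<close>

lemma (in radial_metric_poset) up_dist_triangle: "up_dist x z \<le> up_dist x y + up_dist y z"
proof (cases "geq z x")
  case True
  then show ?thesis using up_dist_nonneg[of x y] up_dist_nonneg[of y z] by (simp add: up_dist_def)
next
  case zx: False
  consider "geq y x" "geq z y" | "geq y x" "\<not> geq z y" | "\<not> geq y x" "geq z y"
    | "\<not> geq y x" "\<not> geq z y" by blast
  then show ?thesis
  proof cases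
    case 1
    then show ?thesis using zx trans_geq by (meson transpD)
  next
    case 2
    then have "dist x z \<le> dist y z"
      using radial_snd[of y x z] zx by (cases "x = y") (auto simp: strict_def not_below_def)
    then show ?thesis using 2 zx by (simp add: up_dist_def)
  next
    case 3
    then have "dist x z \<le> dist x y"
      using radial_fst[of x z y] zx by (cases "y = z") (auto simp: strict_def not_below_def)
    then show ?thesis using 3 zx by (simp add: up_dist_def)
  next
    case 4
    then show ?thesis using zx dist_triangle[of x z y] by (simp add: up_dist_def)
  qed
qed

section \<open>The extension theorem\<close>

theorem theorem13:
  fixes geq :: "'a::metric_space \<Rightarrow> 'a \<Rightarrow> bool"
    and S :: "'a set"
    and f :: "'a \<Rightarrow> real"
  assumes "radial_metric_poset geq"
    and "monotone_on S geq (\<ge>) f"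
    and "uniformly_continuous_on S f"
    and "lipschitz_for_large_distances_on S f"
  shows "\<exists>F :: 'a \<Rightarrow> real. monotone_on UNIV geq (\<ge>) F \<and> uniformly_continuous_on UNIV F \<and>
    (\<forall>x\<in>S. F x = f x)"
proof -
  interpret radial_metric_poset geq by fact
  obtain \<omega> where \<omega>0: "\<omega> 0 = 0"
    and mono: "\<And>s t. 0 \<le> s \<Longrightarrow> s \<le> t \<Longrightarrow> \<omega> s \<le> \<omega> t"
    and subadd: "\<And>s t. 0 \<le> s \<Longrightarrow> 0 \<le> t \<Longrightarrow> \<omega> (s + t) \<le> \<omega> s + \<omega> t"
    and small: "\<And>\<epsilon>. 0 < \<epsilon> \<Longrightarrow> \<exists>\<delta>>0. \<forall>t. 0 \<le> t \<and> t < \<delta> \<longrightarrow> \<omega> t < \<epsilon>"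
    and f\<omega>: "\<And>x y. x \<in> S \<Longrightarrow> y \<in> S \<Longrightarrow> \<bar>f x - f y\<bar> \<le> \<omega> (dist x y)"
    using subadditive_modulus[OF assms(3,4)] by blast
  define q where "q x y = \<omega> (up_dist x y)" for x y
  have "q x x = 0" for x
    by (simp add: q_def up_dist_self \<omega>0)
  moreover have "q x z \<le> q x y + q y z" for x y z
  proof -
    have "q x z \<le> \<omega> (up_dist x y + up_dist y z)"
      unfolding q_def by (intro mono up_dist_nonneg up_dist_triangle)
    also have "\<dots> \<le> q x y + q y z"
      unfolding q_def by (intro subadd up_dist_nonneg)
    finally show ?thesis .
  qed
  moreover have "f x - f y \<le> q x y" if "x \<in> S" "y \<in> S" for x y
  proof (cases "geq y x")
    case True
    then show ?thesis
      using monotone_onD[OF assms(2) that(2,1)] by (simp add: q_def up_dist_def \<omega>0)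
  next
    case False
    then show ?thesis using f\<omega>[OF that] by (simp add: q_def up_dist_def)
  qed
  ultimately obtain F where F_eq: "\<And>x. x \<in> S \<Longrightarrow> F x = f x" and F_le: "\<And>x y. F x - F y \<le> q x y"
    using McShane_extension_quasi[of q S f] by blast
  have "monotone_on UNIV geq (\<ge>) F"
  proof (rule monotone_onI)
    fix x y assume "geq x y"
    then show "F y \<le> F x" using F_le[of y x] by (simp add: q_def up_dist_def \<omega>0)
  qed
  moreover have "uniformly_continuous_on UNIV F"
    unfolding uniformly_continuous_on_def
  proof (intro allI impI)
    fix \<epsilon> :: real assume "0 < \<epsilon>"
    then obtain \<delta> where \<delta>: "0 < \<delta>" "\<And>t. 0 \<le> t \<Longrightarrow> t < \<delta> \<Longrightarrow> \<omega> t < \<epsilon>"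
      using small by blast
    have "F x - F y < \<epsilon>" if "dist x y < \<delta>" for x y
      using F_le[of x y] \<delta>(2)[of "up_dist x y"] up_dist_nonneg[of x y] up_dist_le_dist[of x y] that
      unfolding q_def by linarith
    then have "\<bar>F y - F x\<bar> < \<epsilon>" if "dist y x < \<delta>" for x y
      using that by (simp add: abs_less_iff dist_commute)
    then show "\<exists>\<delta>>0. \<forall>x\<in>UNIV. \<forall>y\<in>UNIV. dist y x < \<delta> \<longrightarrow> dist (F y) (F x) < \<epsilon>"
      using \<delta>(1) by (auto simp: dist_real_def)
  qed
  ultimately show ?thesis using F_eq by blast
qed

end
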